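(* Let $q$ be a prime power, let $\mathbb{F}_q$ be the finite field with $q$ elements and let $A$ be a subset of $\mathbb{F}_q\setminus\{0\}$. (1) If $|A|\geq q^{2/3}$ then $|A+AA|>\frac{q}{2}$. (2) If $|A|=q^{1/2+\delta}$ for some $\delta\in(0,\frac16)$, then $|A+AA|>\frac12 q^{1/2+3\delta}$.
   Context: $A+AA=\{a+bc \mid a,b,c\in A\}$. *)

theory Defs
  imports Complex_Main "HOL-Library.Cardinality" "HOL-Number_Theory.Prime_Powers"
begin

definition sum_prod_set :: "'a::semiring set \<Rightarrow> 'a set" where
  "sum_prod_set A = {a + b * c | a b c. a \<in> A \<and> b \<in> A \<and> c \<in> A}"

end

theory Submission
  imports Defs "HOL-Analysis.Convex"
begin

text \<open>
  Write \<open>n\<close> for the cardinality of \<open>A\<close>, and let \<open>E b\<close> be the number of solutions in \<open>A\<close> of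
  \<open>a + b * c = a' + b * c'\<close>. By Cauchy--Schwarz, \<open>E b \<ge> n^4 / q\<close> for every \<open>b\<close>, while the sum of
  \<open>E b - n^4 / q\<close> over all nonzero \<open>b\<close> is at most \<open>n^2 * (q - n)^2 / q < q * n^2\<close>. As all these terms
  are nonnegative, already some \<open>b\<close> in \<open>A\<close> satisfies \<open>E b < n^4 / q + q * n\<close>, and Cauchy--Schwarz
  bounds the cardinality of \<open>{a + b * c | a c. a \<in> A \<and> c \<in> A}\<close> from below for this \<open>b\<close>.
\<close>

text \<open>Counts ordered pairs, the diagonal included: the second moment of the fibre sizes of
  \<open>f\<close> on \<open>P\<close>. It is real-valued to suit the later averaging.\<close>

definition collisions :: "('p \<Rightarrow> 'b) \<Rightarrow> 'p set \<Rightarrow> real" where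
  "collisions f P = (\<Sum>p\<in>P. \<Sum>p'\<in>P. of_bool (f p = f p'))"

text \<open>Cauchy-Schwarz for the fibre sizes \<open>r x\<close>: they sum to
  \<open>card P\<close>, and their squares sum to the number of collisions.\<close>

lemma card_power2_le_collisions:
  assumes "finite X" and "f ` P \<subseteq> X"
  shows "(real (card P))\<^sup>2 \<le> real (card X) * collisions f P"
proof -
  define r where "r x = (\<Sum>p\<in>P. of_bool (f p = x) :: real)" for x
  have one: "(\<Sum>x\<in>X. of_bool (f p = x) :: real) = 1" if "p \<in> P" for p
    using assms that by (simp add: of_bool_def image_subset_iff)
  have sum_r: "(\<Sum>x\<in>X. r x) = real (card P)"
    unfolding r_def by (subst sum.swap) (simp add: one)
  have "(\<Sum>x\<in>X. (r x)\<^sup>2) =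
      (\<Sum>x\<in>X. \<Sum>p\<in>P. \<Sum>p'\<in>P. of_bool (f p = x) * of_bool (f p' = x))"
    by (simp add: r_def power2_eq_square sum_product)
  also have "\<dots> = (\<Sum>p\<in>P. \<Sum>x\<in>X. \<Sum>p'\<in>P. of_bool (f p = x) * of_bool (f p' = x))"
    by (rule sum.swap)
  also have "\<dots> = (\<Sum>p\<in>P. \<Sum>p'\<in>P. \<Sum>x\<in>X. of_bool (f p = x) * of_bool (f p' = x))"
    by (intro sum.cong refl sum.swap)
  also have "\<dots> = (\<Sum>p\<in>P. \<Sum>p'\<in>P. of_bool (f p = f p') * (\<Sum>x\<in>X. of_bool (f p = x)))"
    by (intro sum.cong refl, unfold sum_distrib_left, intro sum.cong) auto
  also have "\<dots> = collisions f P"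
    by (simp add: collisions_def one)
  finally show ?thesis
    using sum_squared_le_sum_of_squares[of r X] sum_r by (simp add: mult.commute)
qed

text \<open>Equal points collide for all nonzero \<open>b\<close>. Points differing in both
  coordinates collide only for the slope of a line, and points differing in exactly one never do.
  Writing the bound with products lets it factor when summed over \<open>A\<close>.\<close>

lemma card_slope_le:
  fixes a c a' c' :: "'a::{field,finite}"
  shows "(\<Sum>b\<in>UNIV - {0}. of_bool (a + b * c = a' + b * c') :: real) \<le>
    (real CARD('a) - 1) * (of_bool (a = a') * of_bool (c = c'))
      + of_bool (a \<noteq> a') * of_bool (c \<noteq> c')"
proof (cases "c = c'")
  case True
  have "1 \<le> CARD('a)" by (simp add: Suc_leI)
  with True show ?thesis by (simp add: card_Diff_singleton of_nat_diff)
next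
  \<comment> \<open>The only candidate for \<open>b\<close> is nonzero exactly when \<open>a\<close>
    and \<open>a'\<close> differ.\<close>
  case False
  have eq: "a + b * c = a' + b * c' \<longleftrightarrow> b = (a' - a) / (c - c')" for b
    using False by (auto simp: field_simps)
  show ?thesis
    using False by (simp add: eq of_bool_def)
qed

text \<open>Double counting: sum over \<open>b\<close> first, for each fixed pair of points.\<close>

lemma sum_collisions_le:
  fixes A :: "'a::{field,finite} set"
  defines "n \<equiv> real (card A)"
  shows "(\<Sum>b\<in>UNIV - {0}. collisions (\<lambda>(a, c). a + b * c) (A \<times> A)) \<le>
    (real CARD('a) - 1) * n\<^sup>2 + (n * (n - 1))\<^sup>2"
proof -
  let ?g = "\<lambda>b (a, c) (a', c'). of_bool (a + b * c = a' + b * c') :: real"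
  have diag: "(\<Sum>a\<in>A. \<Sum>a'\<in>A. of_bool (a = a')) = n"
    by (simp add: of_bool_def n_def)
  have "(\<Sum>a\<in>A. \<Sum>a'\<in>A. of_bool (a \<noteq> a')) = (\<Sum>a\<in>A. \<Sum>a'\<in>A. 1 - of_bool (a = a') :: real)"
    by (intro sum.cong) auto
  also have "\<dots> = n * n - n"
    unfolding sum_subtractf diag by (simp add: n_def)
  finally have offdiag: "(\<Sum>a\<in>A. \<Sum>a'\<in>A. of_bool (a \<noteq> a')) = n * (n - 1)"
    by (simp add: right_diff_distrib)
  have prod: "(\<Sum>a\<in>A. \<Sum>c\<in>A. \<Sum>a'\<in>A. \<Sum>c'\<in>A. u a a' * u c c') =
      (\<Sum>a\<in>A. \<Sum>a'\<in>A. u a a')\<^sup>2" for u :: "'a \<Rightarrow> 'a \<Rightarrow> real"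
    by (simp add: power2_eq_square sum_product)
  \<comment> \<open>Each term imposes the same condition on \<open>(a, a')\<close> and on
    \<open>(c, c')\<close>, so its fourfold sum is the square of a double sum.\<close>
  have prod_add: "(\<Sum>a\<in>A. \<Sum>c\<in>A. \<Sum>a'\<in>A. \<Sum>c'\<in>A. k * (u a a' * u c c') + v a a' * v c c') =
      k * (\<Sum>a\<in>A. \<Sum>a'\<in>A. u a a')\<^sup>2 + (\<Sum>a\<in>A. \<Sum>a'\<in>A. v a a')\<^sup>2"
    for k and u v :: "'a \<Rightarrow> 'a \<Rightarrow> real"
    unfolding prod[symmetric] by (simp only: sum.distrib sum_distrib_left)
  have "(\<Sum>b\<in>UNIV - {0}. collisions (\<lambda>(a, c). a + b * c) (A \<times> A)) =
      (\<Sum>b\<in>UNIV - {0}. \<Sum>p\<in>A \<times> A. \<Sum>p'\<in>A \<times> A. ?g b p p')"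
    by (simp add: collisions_def split_def)
  also have "\<dots> = (\<Sum>p\<in>A \<times> A. \<Sum>b\<in>UNIV - {0}. \<Sum>p'\<in>A \<times> A. ?g b p p')"
    by (rule sum.swap)
  also have "\<dots> = (\<Sum>p\<in>A \<times> A. \<Sum>p'\<in>A \<times> A. \<Sum>b\<in>UNIV - {0}. ?g b p p')"
    by (intro sum.cong refl sum.swap)
  also have "\<dots> = (\<Sum>a\<in>A. \<Sum>c\<in>A. \<Sum>a'\<in>A. \<Sum>c'\<in>A.
      \<Sum>b\<in>UNIV - {0}. of_bool (a + b * c = a' + b * c'))"
    by (simp add: sum.cartesian_product')
  also have "\<dots> \<le> (\<Sum>a\<in>A. \<Sum>c\<in>A. \<Sum>a'\<in>A. \<Sum>c'\<in>A.
      (real CARD('a) - 1) * (of_bool (a = a') * of_bool (c = c'))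
        + of_bool (a \<noteq> a') * of_bool (c \<noteq> c'))"
    by (intro sum_mono card_slope_le)
  also have "\<dots> = (real CARD('a) - 1) * n\<^sup>2 + (n * (n - 1))\<^sup>2"
    unfolding prod_add diag offdiag ..
  finally show ?thesis .
qed

lemma exists_few_collisions:
  fixes A :: "'a::{field,finite} set"
  assumes "0 \<notin> A" and "A \<noteq> {}"
  defines "n \<equiv> real (card A)" and "q \<equiv> real CARD('a)"
  shows "\<exists>b\<in>A. collisions (\<lambda>(a, c). a + b * c) (A \<times> A) < n ^ 4 / q + q * n"
proof (rule ccontr)
  define E where "E b = collisions (\<lambda>(a, c). a + b * c) (A \<times> A)" for b
  assume "\<not> ?thesis"
  then have large: "q * n \<le> E b - n ^ 4 / q" if "b \<in> A" for b
    using that by (auto simp: E_def not_less dest!: bspec)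
  have n0: "0 < n" and q0: "0 < q"
    using assms(2) by (simp_all add: n_def q_def card_gt_0_iff)
  have "n \<le> q"
    by (simp add: n_def q_def card_mono)
  \<comment> \<open>Cauchy-Schwarz with the whole field as target; this permits enlarging the range
    of \<open>b\<close> from \<open>A\<close> to all nonzero elements below.\<close>
  have nonneg: "0 \<le> E b - n ^ 4 / q" for b
    using card_power2_le_collisions[of UNIV "\<lambda>(a, c). a + b * c" "A \<times> A"] q0
    by (simp add: E_def n_def q_def card_cartesian_product field_simps power2_eq_square
        power4_eq_xxxx)
  have "q * n\<^sup>2 = (\<Sum>b\<in>A. q * n)"
    by (simp add: n_def power2_eq_square)
  also have "\<dots> \<le> (\<Sum>b\<in>A. E b - n ^ 4 / q)"
    by (intro sum_mono large)
  also have "\<dots> \<le> (\<Sum>b\<in>UNIV - {0}. E b - n ^ 4 / q)"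
    using assms(1) nonneg by (intro sum_mono2) auto
  also have "\<dots> \<le> (q - 1) * n\<^sup>2 + (n * (n - 1))\<^sup>2 - (q - 1) * (n ^ 4 / q)"
    using sum_collisions_le[of A]
    by (simp add: sum_subtractf card_Diff_singleton of_nat_diff Suc_leI E_def n_def q_def)
  also have "\<dots> = n\<^sup>2 * (q - n)\<^sup>2 / q"
    using q0 by (simp add: field_simps power2_eq_square power4_eq_xxxx)
  \<comment> \<open>Strict because \<open>0 < n\<close>, which is what produces the
    contradiction.\<close>
  also have "\<dots> < n\<^sup>2 * q\<^sup>2 / q"
    using n0 q0 \<open>n \<le> q\<close>
    by (intro divide_strict_right_mono mult_strict_left_mono power_strict_mono) auto
  also have "\<dots> = q * n\<^sup>2"
    using q0 by (simp add: power2_eq_square)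
  finally show False by simp
qed

text \<open>Apply Cauchy-Schwarz to the \<open>b\<close> with few collisions, then cancel
  \<open>n\<close> and clear \<open>q\<close>. In this form both regimes follow by asking which of
  \<open>n ^ 3\<close> and \<open>q\<^sup>2\<close> dominates.\<close>

lemma card_sum_prod_set_gt:
  fixes A :: "'a::{field,finite} set"
  assumes "0 \<notin> A" and "A \<noteq> {}"
  defines "n \<equiv> real (card A)" and "q \<equiv> real CARD('a)"
  shows "q * n ^ 3 < real (card (sum_prod_set A)) * (n ^ 3 + q\<^sup>2)"
proof -
  let ?S = "sum_prod_set A"
  obtain b where b: "b \<in> A"
    and few: "collisions (\<lambda>(a, c). a + b * c) (A \<times> A) < n ^ 4 / q + q * n"
    using exists_few_collisions[OF assms(1,2)] unfolding n_def q_def by blast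
  have n0: "0 < n" and q0: "0 < q"
    using assms(2) by (simp_all add: n_def q_def card_gt_0_iff)
  have sub: "(\<lambda>(a, c). a + b * c) ` (A \<times> A) \<subseteq> ?S"
    using b by (auto simp: sum_prod_set_def)
  have "?S \<noteq> {}"
    using sub assms(2) by auto
  then have "0 < real (card ?S)"
    by (simp add: card_gt_0_iff)
  have "n * n ^ 3 = (real (card (A \<times> A)))\<^sup>2"
    by (simp add: n_def card_cartesian_product power2_eq_square power3_eq_cube)
  also have "\<dots> \<le> real (card ?S) * collisions (\<lambda>(a, c). a + b * c) (A \<times> A)"
    using sub by (intro card_power2_le_collisions) auto
  also have "\<dots> < real (card ?S) * (n ^ 4 / q + q * n)"
    using few \<open>0 < real (card ?S)\<close> by (rule mult_strict_left_mono)
  also have "\<dots> = n * (real (card ?S) * (n ^ 3 + q\<^sup>2) / q)"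
    using q0 by (simp add: field_simps power2_eq_square power3_eq_cube power4_eq_xxxx)
  finally have "n ^ 3 < real (card ?S) * (n ^ 3 + q\<^sup>2) / q"
    using n0 by (simp only: mult_less_cancel_left_pos)
  then show ?thesis
    using q0 by (simp add: pos_less_divide_eq mult.commute)
qed

theorem proposition1p7:
  fixes q :: nat and A :: "'a::{field,finite} set"
  assumes "primepow q"
    and "CARD('a) = q"
    and "A \<subseteq> UNIV - {0}"
  shows "(real (card A) \<ge> real q powr (2/3) \<longrightarrow>
            real (card (sum_prod_set A)) > real q / 2) \<and>
         (\<forall>\<delta>::real. 0 < \<delta> \<and> \<delta> < 1/6 \<and> real (card A) = real q powr (1/2 + \<delta>) \<longrightarrow>
            real (card (sum_prod_set A)) > 1/2 * real q powr (1/2 + 3 * \<delta>))"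
proof (intro conjI allI impI)
  let ?n = "real (card A)" and ?s = "real (card (sum_prod_set A))"
  have q1: "1 \<le> real q"
    using assms(2) by (auto simp: Suc_leI)
  have key: "real q * ?n ^ 3 < ?s * (?n ^ 3 + (real q)\<^sup>2)" if "0 < ?n"
  proof -
    have "0 \<notin> A" and "A \<noteq> {}"
      using that assms(3) by auto
    then show ?thesis
      using card_sum_prod_set_gt[of A] assms(2) by simp
  qed
  show "real q / 2 < ?s" if n: "real q powr (2/3) \<le> ?n"
  proof -
    have "0 < real q powr (2/3)"
      using q1 by simp
    with n have n0: "0 < ?n" by linarith
    \<comment> \<open>The threshold 2/3 is where \<open>n ^ 3\<close> reaches
      \<open>q\<^sup>2\<close>; above it the bracket in \<open>key\<close> is at most twice the
      cube.\<close>
    have "(real q)\<^sup>2 = (real q powr (2/3)) ^ 3"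
      using q1 by (simp add: powr_power)
    also have "\<dots> \<le> ?n ^ 3"
      using n by (intro power_mono) auto
    finally have "?s * (?n ^ 3 + (real q)\<^sup>2) \<le> ?s * (?n ^ 3 + ?n ^ 3)"
      by (intro mult_left_mono add_left_mono) auto
    with key[OF n0] have "real q * ?n ^ 3 < (2 * ?s) * ?n ^ 3"
      by (simp add: algebra_simps)
    then show ?thesis
      using n0 by simp
  qed
  show "1/2 * real q powr (1/2 + 3 * \<delta>) < ?s"
    if \<delta>: "0 < \<delta> \<and> \<delta> < 1/6 \<and> ?n = real q powr (1/2 + \<delta>)" for \<delta> :: real
  proof -
    from \<delta> have n: "?n = real q powr (1/2 + \<delta>)" by simp
    have n0: "0 < ?n"
      using n q1 by simp
    have cube: "?n ^ 3 = real q powr (3/2 + 3 * \<delta>)"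
      using q1 by (simp add: n powr_power algebra_simps)
    \<comment> \<open>From \<delta> < 1/6 the exponent stays below 2, so now the square of
      \<open>q\<close> dominates the bracket.\<close>
    also have "\<dots> \<le> real q powr 2"
      using \<delta> q1 by (intro powr_mono) auto
    finally have "?s * (?n ^ 3 + (real q)\<^sup>2) \<le> ?s * ((real q)\<^sup>2 + (real q)\<^sup>2)"
      using q1 by (intro mult_left_mono add_right_mono) auto
    with key[OF n0] have "real q * ?n ^ 3 < real q * (2 * ?s * real q)"
      by (simp add: algebra_simps power2_eq_square)
    then have "?n ^ 3 < 2 * ?s * real q"
      using q1 by simp
    also have "?n ^ 3 = real q powr (1/2 + 3 * \<delta>) * real q"
      using q1 powr_mult_base[of "real q" "1/2 + 3 * \<delta>"] by (simp add: cube mult.commute)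
    finally show ?thesis
      using q1 by simp
  qed
qed

end
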